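(* If $n\geq m\geq 2$ are integers, then $\chi_L(P_m\square P_n)=4$.
   Context: $P_k$ is the path on $k$ vertices and $\square$ is the cartesian product of graphs: $V(G\square H)=V(G)\times V(H)$, with $(a,b)\sim(a',b')$ iff ($a=a'$ and $bb'\in E(H)$) or ($aa'\in E(G)$ and $b=b'$). For a connected graph $G$, with $d$ the shortest-path distance and $d(v,S)=\min_{x\in S}d(v,x)$, a proper $k$-coloring with ordered color classes $(V_1,\dots,V_k)$ is a locating coloring if the color codes $(d(v,V_1),\dots,d(v,V_k))$ of distinct vertices $v$ are distinct; $\chi_L(G)$ is the minimum $k$ for which a locating $k$-coloring exists. *)

theory Defs
  imports "Graph_Theory.Graph_Theory" "Graph_Theory.Shortest_Path"
begin

text \<open>
  A simple graph is represented as a symmetric loop-free digraph (locale \<^locale>\<open>pair_graph\<close>):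
  an edge between u and v stands for the two arcs (u, v) and (v, u).
\<close>

definition path_graph :: "nat \<Rightarrow> nat pair_pre_digraph" where
  "path_graph n = \<lparr> pverts = {..<n},
     parcs = {(i, j). i < n \<and> j < n \<and> (j = Suc i \<or> i = Suc j)} \<rparr>"

definition cartesian_product ::
    "'a pair_pre_digraph \<Rightarrow> 'b pair_pre_digraph \<Rightarrow> ('a \<times> 'b) pair_pre_digraph"
    (infixr \<open>\<box>\<close> 70) where
  "G \<box> H = \<lparr> pverts = pverts G \<times> pverts H,
     parcs = {((a, b), (a', b')). a = a' \<and> a \<in> pverts G \<and> (b, b') \<in> parcs H} \<union>
             {((a, b), (a', b')). (a, a') \<in> parcs G \<and> b = b' \<and> b \<in> pverts H} \<rparr>"

lemma pair_graph_path_graph: "pair_graph (path_graph n)"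
proof
  show "finite (parcs (path_graph n))"
    by (rule finite_subset[of _ "{..<n} \<times> {..<n}"]) (auto simp: path_graph_def)
  show "symmetric (with_proj (path_graph n))"
    unfolding symmetric_def sym_def by (auto simp: path_graph_def)
qed (auto simp: path_graph_def)

lemma pair_graph_cartesian_product:
  assumes "pair_graph G" and "pair_graph H"
  shows "pair_graph (G \<box> H)"
proof -
  interpret G: pair_graph G by fact
  interpret H: pair_graph H by fact
  have symG: "(a, b) \<in> parcs G \<Longrightarrow> (b, a) \<in> parcs G" for a b
    using G.pair_sym_arcs unfolding symmetric_def sym_def by simp
  have symH: "(a, b) \<in> parcs H \<Longrightarrow> (b, a) \<in> parcs H" for a b
    using H.pair_sym_arcs unfolding symmetric_def sym_def by simp
  have arcs: "parcs (G \<box> H) \<subseteq> (pverts G \<times> pverts H) \<times> (pverts G \<times> pverts H)"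
    by (auto simp: cartesian_product_def dest: G.in_arcsD1 G.in_arcsD2 H.in_arcsD1 H.in_arcsD2)
  show ?thesis
  proof
    show "fst e \<in> pverts (G \<box> H)" "snd e \<in> pverts (G \<box> H)" if "e \<in> parcs (G \<box> H)" for e
      using subsetD[OF arcs that] by (auto simp: cartesian_product_def)
    show "finite (pverts (G \<box> H))"
      by (simp add: cartesian_product_def G.pair_finite_verts H.pair_finite_verts)
    show "finite (parcs (G \<box> H))"
      using arcs by (rule finite_subset) (simp add: G.pair_finite_verts H.pair_finite_verts)
    show "symmetric (with_proj (G \<box> H))"
      unfolding symmetric_def sym_def by (auto simp: cartesian_product_def symG symH)
    show "fst e \<noteq> snd e" if "e \<in> parcs (G \<box> H)" for e
      using that G.pair_no_loops H.pair_no_loops by (fastforce simp: cartesian_product_def)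
  qed
qed

text \<open>
  Unit weights make the weighted distance the least number of arcs of a walk.  The constant
  \<open>wf_digraph.\<mu>\<close> carries information only for well-formed digraphs, so in particular
  for every \<^locale>\<open>pair_graph\<close>.
\<close>

definition graph_dist :: "'a pair_pre_digraph \<Rightarrow> 'a \<Rightarrow> 'a \<Rightarrow> ereal" where
  "graph_dist G u v = wf_digraph.\<mu> (with_proj G) (\<lambda>_. 1) u v"

text \<open>The infimum over a nonempty set is a minimum, since all distances lie in
  \<open>\<nat> \<union> {\<infinity>}\<close>.\<close>

definition dist_to_set :: "'a pair_pre_digraph \<Rightarrow> 'a \<Rightarrow> 'a set \<Rightarrow> ereal" where
  "dist_to_set G v S = (INF x\<in>S. graph_dist G v x)"

text \<open>The colors are \<open>0, \<dots>, k - 1\<close>, and every color class is nonempty.\<close>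

definition proper_coloring :: "'a pair_pre_digraph \<Rightarrow> nat \<Rightarrow> ('a \<Rightarrow> nat) \<Rightarrow> bool" where
  "proper_coloring G k c \<longleftrightarrow>
     c ` pverts G = {..<k} \<and> (\<forall>(u, v) \<in> parcs G. c u \<noteq> c v)"

definition color_class :: "'a pair_pre_digraph \<Rightarrow> ('a \<Rightarrow> nat) \<Rightarrow> nat \<Rightarrow> 'a set" where
  "color_class G c i = {v \<in> pverts G. c v = i}"

definition color_code ::
    "'a pair_pre_digraph \<Rightarrow> nat \<Rightarrow> ('a \<Rightarrow> nat) \<Rightarrow> 'a \<Rightarrow> ereal list" where
  "color_code G k c v = map (\<lambda>i. dist_to_set G v (color_class G c i)) [0..<k]"

definition locating_coloring :: "'a pair_pre_digraph \<Rightarrow> nat \<Rightarrow> ('a \<Rightarrow> nat) \<Rightarrow> bool" where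
  "locating_coloring G k c \<longleftrightarrow> proper_coloring G k c \<and> inj_on (color_code G k c) (pverts G)"

text \<open>The set of such k is nonempty for a finite graph, as an injective coloring is locating.\<close>

definition locating_chromatic_number :: "'a pair_pre_digraph \<Rightarrow> nat" (\<open>\<chi>\<^sub>L\<close>) where
  "\<chi>\<^sub>L G = (LEAST k. \<exists>c. locating_coloring G k c)"

end

theory Submission
  imports Defs
begin

text \<open>
  Lower bound: a vertex is colorful if its neighbours carry all the other colors.  Two colorful
  vertices of the same color have the same code, so a locating coloring has at most one of them per
  color.  If at most three colors occur and some 4-cycle has a pair of opposite vertices of
  different colors, then the other two vertices are colorful of the same (third) color.  Hence
  opposite vertices of each unit square agree; this forces the chessboard coloring of
  the whole grid, where every vertex is colorful, a contradiction.

  Upper bound: give two corners at the ends of one side a private color each and color the rest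
  like a chessboard.  The distances to the two corners already determine a vertex.
\<close>

section \<open>Bounds on graph distance from potential functions\<close>

text \<open>The potential \<open>f\<close> drops by at most one along each arc and vanishes at
  \<open>t\<close>, so a walk from \<open>u\<close> to \<open>t\<close> needs at least
  \<open>f u\<close> arcs.\<close>

lemma graph_dist_ge:
  fixes f :: "'a \<Rightarrow> nat"
  assumes G: "pair_graph G" and t: "f t = 0"
    and lip: "\<And>u v. (u, v) \<in> parcs G \<Longrightarrow> f u \<le> Suc (f v)"
  shows "ereal (real (f u)) \<le> graph_dist G u t"
proof -
  interpret pair_graph G by fact
  have "f u \<le> length p" if "awalk u p t" for p
    using that
  proof (induction p arbitrary: u)
    case Nil
    then show ?case using t by (simp add: awalk_Nil_iff)
  next
    case (Cons e p)
    then have e: "e \<in> parcs G" "u = fst e" "awalk (snd e) p t"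
      by (simp_all add: awalk_Cons_iff)
    then show ?case using Cons.IH[OF e(3)] lip[of "fst e" "snd e"] by simp
  qed
  \<comment> \<open>With unit weights the cost of a walk is its length. If no walk exists, the
    infimum is infinite and the bound still holds.\<close>
  then show ?thesis
    unfolding graph_dist_def \<mu>_def awalk_cost_def
    by (intro INF_greatest) (simp add: sum_list_triv)
qed

text \<open>Repeatedly stepping to a neighbour where \<open>f\<close> is one smaller gives a walk
  with exactly \<open>f u\<close> arcs; it can only end at the unique zero \<open>t\<close>.\<close>

lemma graph_dist_le:
  fixes f :: "'a \<Rightarrow> nat"
  assumes G: "pair_graph G" and u: "u \<in> pverts G"
    and zero: "\<And>v. v \<in> pverts G \<Longrightarrow> f v = 0 \<Longrightarrow> v = t"
    and desc: "\<And>v. v \<in> pverts G \<Longrightarrow> f v \<noteq> 0 \<Longrightarrow> \<exists>w. (v, w) \<in> parcs G \<and> f v = Suc (f w)"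
  shows "graph_dist G u t \<le> ereal (real (f u))"
proof -
  interpret pair_graph G by fact
  have "\<exists>p. awalk u p t \<and> length p = f u"
    using u
  proof (induction "f u" arbitrary: u)
    case 0
    then have "awalk u [] t" using zero[of u] by (simp add: awalk_Nil_iff)
    then show ?case using 0 by force
  next
    case (Suc k)
    then obtain w where w: "(u, w) \<in> parcs G" "f u = Suc (f w)"
      using desc[of u] by auto
    moreover have "w \<in> pverts G" using w(1) in_arcsD2 by blast
    ultimately obtain p where "awalk w p t" "length p = f w"
      using Suc.hyps by auto
    with w have "awalk u ((u, w) # p) t" "length ((u, w) # p) = f u"
      by (simp_all add: awalk_Cons_iff)
    then show ?case by blast
  qed
  then obtain p where "awalk u p t" "length p = f u" by blast
  then show ?thesis
    unfolding graph_dist_def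
    using min_cost_le_walk_cost[of u p t "\<lambda>_. 1"] by (simp add: awalk_cost_def sum_list_triv)
qed

lemma graph_dist_ge_1:
  assumes "pair_graph G" and "u \<noteq> v"
  shows "1 \<le> graph_dist G u v"
  using graph_dist_ge[OF assms(1), of "\<lambda>x. if x = v then 0 else 1" v u] assms(2)
  by (simp add: one_ereal_def)

lemma graph_dist_nonneg: "pair_graph G \<Longrightarrow> 0 \<le> graph_dist G u v"
  using graph_dist_ge[of G "\<lambda>_. 0" v u] by (simp add: zero_ereal_def)

lemma graph_dist_self:
  assumes G: "pair_graph G" and u: "u \<in> pverts G"
  shows "graph_dist G u u = 0"
proof -
  interpret pair_graph G by fact
  have "graph_dist G u u \<le> 0"
    unfolding graph_dist_def
    using min_cost_le_walk_cost[of u "[]" u "\<lambda>_. 1"] u by (simp add: awalk_Nil_iff zero_ereal_def)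
  with graph_dist_nonneg[OF G] show ?thesis by (simp add: antisym)
qed

lemma graph_dist_arc:
  assumes G: "pair_graph G" and uv: "(u, v) \<in> parcs G"
  shows "graph_dist G u v = 1"
proof -
  interpret pair_graph G by fact
  have "awalk u [(u, v)] v"
    using uv in_arcsD2 by (fastforce simp: awalk_simps)
  then have "graph_dist G u v \<le> 1"
    unfolding graph_dist_def
    using min_cost_le_walk_cost[of u "[(u, v)]" v "\<lambda>_. 1"] by (simp add: one_ereal_def)
  moreover have "u \<noteq> v" using uv pair_no_loops by fastforce
  ultimately show ?thesis using graph_dist_ge_1[OF G] by (simp add: antisym)
qed

section \<open>Color codes of colorful vertices\<close>

lemma dist_to_own_class:
  assumes G: "pair_graph G" and u: "u \<in> pverts G"
  shows "dist_to_set G u (color_class G c (c u)) = 0"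
proof (rule antisym)
  show "dist_to_set G u (color_class G c (c u)) \<le> 0"
    unfolding dist_to_set_def
    by (rule INF_lower2[of u]) (simp_all add: color_class_def u graph_dist_self[OF G u])
  show "0 \<le> dist_to_set G u (color_class G c (c u))"
    unfolding dist_to_set_def by (intro INF_greatest graph_dist_nonneg[OF G])
qed

lemma dist_to_adjacent_class:
  assumes G: "pair_graph G" and uv: "(u, v) \<in> parcs G" and "c u \<noteq> c v"
  shows "dist_to_set G u (color_class G c (c v)) = 1"
proof (rule antisym)
  interpret pair_graph G by fact
  have "v \<in> pverts G" using uv in_arcsD2 by blast
  then show "dist_to_set G u (color_class G c (c v)) \<le> 1"
    unfolding dist_to_set_def
    by (intro INF_lower2[of v]) (simp_all add: color_class_def graph_dist_arc[OF G uv])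
  show "1 \<le> dist_to_set G u (color_class G c (c v))"
    unfolding dist_to_set_def using assms(3)
    by (intro INF_greatest graph_dist_ge_1[OF G]) (auto simp: color_class_def)
qed

definition colorful :: "'a pair_pre_digraph \<Rightarrow> nat \<Rightarrow> ('a \<Rightarrow> nat) \<Rightarrow> 'a \<Rightarrow> bool" where
  "colorful G k c u \<longleftrightarrow> u \<in> pverts G \<and> (\<forall>i<k. i \<noteq> c u \<longrightarrow> (\<exists>v. (u, v) \<in> parcs G \<and> c v = i))"

text \<open>Every other class is met at distance one, so the code depends on the color
  \<open>c u\<close> alone; this is what makes \<open>colorful_unique\<close> work.\<close>

lemma color_code_colorful:
  assumes G: "pair_graph G" and u: "colorful G k c u"
  shows "color_code G k c u = map (\<lambda>i. if i = c u then 0 else 1) [0..<k]"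
  unfolding color_code_def
proof (rule map_cong[OF refl])
  fix i assume "i \<in> set [0..<k]"
  then show "dist_to_set G u (color_class G c i) = (if i = c u then 0 else 1)"
    using u dist_to_own_class[OF G, of u c] dist_to_adjacent_class[OF G, of u _ c]
    unfolding colorful_def by force
qed

lemma colorful_unique:
  assumes G: "pair_graph G" and c: "locating_coloring G k c"
    and "colorful G k c u" "colorful G k c v" and "c u = c v"
  shows "u = v"
proof -
  have "color_code G k c u = color_code G k c v"
    using assms by (simp add: color_code_colorful)
  then show ?thesis
    using assms unfolding locating_coloring_def colorful_def by (auto dest: inj_onD)
qed

lemma opposite_colors_eq:
  assumes G: "pair_graph G" and c: "locating_coloring G k c" and k: "k \<le> 3"
    and arcs: "(a, b) \<in> parcs G" "(a, d) \<in> parcs G" "(a', b) \<in> parcs G" "(a', d) \<in> parcs G"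
    and "a \<noteq> a'"
  shows "c b = c d"
proof (rule ccontr)
  assume bd: "c b \<noteq> c d"
  interpret pair_graph G by fact
  have V: "a \<in> pverts G" "a' \<in> pverts G" "b \<in> pverts G" "d \<in> pverts G"
    using arcs in_arcsD1 in_arcsD2 by blast+
  have ran: "c x < k" if "x \<in> pverts G" for x
    using c that unfolding locating_coloring_def proper_coloring_def by blast
  have proper: "c x \<noteq> c y" if "(x, y) \<in> parcs G" for x y
    using c that unfolding locating_coloring_def proper_coloring_def by blast
  note ineqs = ran[OF V(1)] ran[OF V(2)] ran[OF V(3)] ran[OF V(4)] bd k
    proper[OF arcs(1)] proper[OF arcs(2)] proper[OF arcs(3)] proper[OF arcs(4)]
  \<comment> \<open>Both \<open>a\<close> and \<open>a'\<close> are adjacent to \<open>b\<close> and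
    \<open>d\<close>, so they avoid two distinct colors; at most one color remains.\<close>
  have "c a = c a'" using ineqs by linarith
  moreover have "i = c a \<or> i = c b \<or> i = c d" if "i < k" for i
    using ineqs that by linarith
  then have "colorful G k c a" "colorful G k c a'"
    using V arcs \<open>c a = c a'\<close> unfolding colorful_def by metis+
  ultimately show False
    using colorful_unique[OF G c] \<open>a \<noteq> a'\<close> by blast
qed

section \<open>Grids and the lower bound\<close>

abbreviation grid :: "nat \<Rightarrow> nat \<Rightarrow> (nat \<times> nat) pair_pre_digraph" where
  "grid m n \<equiv> path_graph m \<box> path_graph n"

lemma pair_graph_grid: "pair_graph (grid m n)"
  by (intro pair_graph_cartesian_product pair_graph_path_graph)

lemma pverts_grid: "pverts (grid m n) = {..<m} \<times> {..<n}"
  by (simp add: cartesian_product_def path_graph_def)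

lemma parcs_grid:
  "((i, j), (i', j')) \<in> parcs (grid m n) \<longleftrightarrow> i < m \<and> j < n \<and> i' < m \<and> j' < n \<and>
     (i = i' \<and> (j' = Suc j \<or> j = Suc j') \<or> j = j' \<and> (i' = Suc i \<or> i = Suc i'))"
  by (auto simp: cartesian_product_def path_graph_def)

text \<open>Row 0 has period two: \<open>(0, j)\<close> and \<open>(0, j + 2)\<close> both agree
  with \<open>(1, j + 1)\<close>. Each later row copies the previous one along diagonals, except
  that its first entry comes from the antidiagonal.\<close>

lemma chessboard_if_squares:
  assumes "2 \<le> m"
    and diag: "\<And>i j. Suc i < m \<Longrightarrow> Suc j < n \<Longrightarrow> c (Suc i, Suc j) = c (i, j)"
    and anti: "\<And>i j. Suc i < m \<Longrightarrow> Suc j < n \<Longrightarrow> c (Suc i, j) = c (i, Suc j)"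
    and n: "2 \<le> n" and "i < m" "j < n"
  shows "c (i, j) = (if even (i + j) then c (0, 0) else c (0, Suc 0))"
  using \<open>i < m\<close> \<open>j < n\<close>
proof (induction i arbitrary: j)
  case 0
  then show ?case
  proof (induction j rule: induct_nat_012)
    case (ge2 j)
    then have "c (0, Suc (Suc j)) = c (0, j)"
      using diag[of 0 j] anti[of 0 "Suc j"] \<open>2 \<le> m\<close> by simp
    with ge2 show ?case by simp
  qed simp_all
next
  case (Suc i)
  show ?case
  proof (cases j)
    case 0
    with Suc n show ?thesis using anti[of i 0] Suc.IH[of "Suc 0"] by simp
  next
    case (Suc j')
    with Suc.prems show ?thesis using diag[of i j'] Suc.IH[of j'] by simp
  qed
qed

lemma locating_coloring_grid_ge_4:
  assumes m: "2 \<le> m" and n: "2 \<le> n" and c: "locating_coloring (grid m n) k c"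
  shows "4 \<le> k"
proof (rule ccontr)
  assume "\<not> 4 \<le> k"
  then have k: "k \<le> 3" by simp
  note G = pair_graph_grid[of m n]
  \<comment> \<open>The same unit square is used twice, once for each pair of opposite
    corners.\<close>
  have "c (Suc i, Suc j) = c (i, j)" "c (Suc i, j) = c (i, Suc j)"
    if "Suc i < m" "Suc j < n" for i j
    using opposite_colors_eq[OF G c k, of "(i, Suc j)" "(Suc i, Suc j)" "(i, j)" "(Suc i, j)"]
      opposite_colors_eq[OF G c k, of "(i, j)" "(Suc i, j)" "(i, Suc j)" "(Suc i, Suc j)"] that
    by (simp_all add: parcs_grid)
  then have board: "c (i, j) = (if even (i + j) then c (0, 0) else c (0, 1))"
    if "i < m" "j < n" for i j
    using chessboard_if_squares[OF m _ _ n that, of c] by simp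
  \<comment> \<open>The coloring is onto \<open>{..<k}\<close>, so the chessboard colors are all
    there are. Hence the common neighbour \<open>(0, 1)\<close> alone makes \<open>(0, 0)\<close>
    and \<open>(1, 1)\<close> colorful.\<close>
  have two: "i = c (0, 0) \<or> i = c (0, 1)" if "i < k" for i
  proof -
    have "i \<in> c ` pverts (grid m n)"
      using c that unfolding locating_coloring_def proper_coloring_def by blast
    then obtain x y where "x < m" "y < n" "i = c (x, y)" by (auto simp: pverts_grid)
    then show ?thesis using board[of x y] by presburger
  qed
  have eq: "c (1, 1) = c (0, 0)" using board[of 1 1] m n by simp
  have "((0, 0), (0, 1)) \<in> parcs (grid m n)" "((1, 1), (0, 1)) \<in> parcs (grid m n)"
    using m n by (simp_all add: parcs_grid)
  moreover have "(0, 0) \<in> pverts (grid m n)" "(1, 1) \<in> pverts (grid m n)"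
    using m n by (simp_all add: pverts_grid)
  ultimately have "colorful (grid m n) k c (0, 0)" "colorful (grid m n) k c (1, 1)"
    using two eq unfolding colorful_def by metis+
  then show False using colorful_unique[OF G c] eq by fastforce
qed

section \<open>Upper bound: the corner coloring\<close>

definition corner_coloring :: "nat \<Rightarrow> nat \<times> nat \<Rightarrow> nat" where
  "corner_coloring m =
     (\<lambda>(i, j). if (i, j) = (0, 0) then 2 else if (i, j) = (m - 1, 0) then 3 else (i + j) mod 2)"

lemma graph_dist_grid_corner:
  assumes "i < m" "j < n"
  shows "graph_dist (grid m n) (i, j) (0, 0) = ereal (real (i + j))"
proof (rule antisym)
  let ?f = "\<lambda>(i, j). i + j"
  show "graph_dist (grid m n) (i, j) (0, 0) \<le> ereal (real (i + j))"
  proof (rule graph_dist_le[OF pair_graph_grid, where f = ?f and u = "(i, j)", unfolded prod.case])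
    fix v assume v: "v \<in> pverts (grid m n)" "?f v \<noteq> 0"
    obtain x y where xy: "v = (x, y)" by fastforce
    \<comment> \<open>Descend to the side \<open>y = 0\<close> first, then along it to the
      corner.\<close>
    let ?w = "if y = 0 then (x - 1, 0) else (x, y - 1)"
    have "(v, ?w) \<in> parcs (grid m n) \<and> ?f v = Suc (?f ?w)"
      using v xy by (auto simp: pverts_grid parcs_grid)
    then show "\<exists>w. (v, w) \<in> parcs (grid m n) \<and> ?f v = Suc (?f w)" by blast
  qed (use assms in \<open>auto simp: pverts_grid\<close>)
  show "ereal (real (i + j)) \<le> graph_dist (grid m n) (i, j) (0, 0)"
    by (rule graph_dist_ge[OF pair_graph_grid, where f = ?f and u = "(i, j)", unfolded prod.case])
       (auto simp: parcs_grid)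
qed

lemma graph_dist_grid_opposite_corner:
  assumes "i < m" "j < n"
  shows "graph_dist (grid m n) (i, j) (m - 1, 0) = ereal (real (m - 1 - i + j))"
proof (rule antisym)
  let ?f = "\<lambda>(i, j). m - 1 - i + j"
  show "graph_dist (grid m n) (i, j) (m - 1, 0) \<le> ereal (real (m - 1 - i + j))"
  proof (rule graph_dist_le[OF pair_graph_grid, where f = ?f and u = "(i, j)", unfolded prod.case])
    fix v assume v: "v \<in> pverts (grid m n)" "?f v \<noteq> 0"
    obtain x y where xy: "v = (x, y)" by fastforce
    \<comment> \<open>On the side \<open>y = 0\<close> a nonzero potential forces
      \<open>x < m - 1\<close>, so \<open>Suc x\<close> stays in the grid.\<close>
    let ?w = "if y = 0 then (Suc x, 0) else (x, y - 1)"
    have "(v, ?w) \<in> parcs (grid m n) \<and> ?f v = Suc (?f ?w)"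
      using v xy by (auto simp: pverts_grid parcs_grid)
    then show "\<exists>w. (v, w) \<in> parcs (grid m n) \<and> ?f v = Suc (?f w)" by blast
  qed (use assms in \<open>auto simp: pverts_grid\<close>)
  show "ereal (real (m - 1 - i + j)) \<le> graph_dist (grid m n) (i, j) (m - 1, 0)"
    by (rule graph_dist_ge[OF pair_graph_grid, where f = ?f and u = "(i, j)", unfolded prod.case])
       (auto simp: parcs_grid)
qed

lemma locating_corner_coloring:
  assumes m: "2 \<le> m" and n: "2 \<le> n"
  shows "locating_coloring (grid m n) 4 (corner_coloring m)"
proof -
  let ?G = "grid m n" and ?c = "corner_coloring m"
  have "?c ` pverts ?G = {..<4}"
  proof
    show "?c ` pverts ?G \<subseteq> {..<4}"
      by (auto simp: corner_coloring_def intro: less_trans[OF mod_less_divisor])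
    \<comment> \<open>The first two witnesses lie off the side containing the special corners, so
      they keep their chessboard colors even for \<open>m = 2\<close>. The two corners differ
      because \<open>2 \<le> m\<close>.\<close>
    have "?c (1, 1) = 0" "?c (0, 1) = 1" "?c (0, 0) = 2" "?c (m - 1, 0) = 3"
      using m by (auto simp: corner_coloring_def)
    moreover have "{(1, 1), (0, 1), (0, 0), (m - 1, 0)} \<subseteq> pverts ?G"
      using m n by (auto simp: pverts_grid)
    ultimately have "{0, 1, 2, 3} \<subseteq> ?c ` pverts ?G" 
      by (metis (no_types, lifting) image_eqI insert_subset empty_subsetI)
    moreover have "{..<4} = {0, 1, 2, 3::nat}" by auto
    ultimately show "{..<4} \<subseteq> ?c ` pverts ?G" by simp
  qed
  moreover have "?c u \<noteq> ?c v" if "(u, v) \<in> parcs ?G" for u v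
  proof -
    obtain i j i' j' where uv: "u = (i, j)" "v = (i', j')" by fastforce
    have "i' + j' = Suc (i + j) \<or> i + j = Suc (i' + j')"
      using that unfolding uv parcs_grid by auto
    then have "even (i + j) \<noteq> even (i' + j')"
      by (elim disjE) simp_all
    then have "(i + j) mod 2 \<noteq> (i' + j') mod 2"
      by (metis even_iff_mod_2_eq_zero)
    \<comment> \<open>These bounds separate chessboard colors from 2 and 3;
      \<open>u \<noteq> v\<close> excludes that both ends are the same special corner.\<close>
    moreover have "(i + j) mod 2 < 2" "(i' + j') mod 2 < 2" by simp_all
    moreover have "u \<noteq> v" using that by (auto simp: uv parcs_grid)
    ultimately show ?thesis
      unfolding uv corner_coloring_def by (auto split: if_splits)
  qed
  ultimately have "proper_coloring ?G 4 ?c" unfolding proper_coloring_def by blast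
  moreover have "inj_on (color_code ?G 4 ?c) (pverts ?G)"
  proof (rule inj_onI, clarify)
    fix i j i' j'
    assume V: "(i, j) \<in> pverts ?G" "(i', j') \<in> pverts ?G"
      and "color_code ?G 4 ?c (i, j) = color_code ?G 4 ?c (i', j')"
    then have eq: "dist_to_set ?G (i, j) (color_class ?G ?c q) =
        dist_to_set ?G (i', j') (color_class ?G ?c q)" if "q < 4" for q
      using that unfolding color_code_def by auto
    \<comment> \<open>Thus classes 2 and 3 are singletons, and the distances to them are distances
      to the corners.\<close>
    have "q mod 2 \<noteq> 2" "q mod 2 \<noteq> 3" for q :: nat
      using mod_less_divisor[of 2 q] by linarith+
    then have "color_class ?G ?c 2 = {(0, 0)}" "color_class ?G ?c 3 = {(m - 1, 0)}"
      using m n by (auto simp: color_class_def corner_coloring_def pverts_grid split: if_splits)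
    then have "graph_dist ?G (i, j) (0, 0) = graph_dist ?G (i', j') (0, 0)"
      "graph_dist ?G (i, j) (m - 1, 0) = graph_dist ?G (i', j') (m - 1, 0)"
      using eq[of 2] eq[of 3] by (simp_all add: dist_to_set_def)
    moreover have V': "i < m" "j < n" "i' < m" "j' < n" using V by (simp_all add: pverts_grid)
    ultimately have "i + j = i' + j'" "m - 1 - i + j = m - 1 - i' + j'"
      by (simp_all only: graph_dist_grid_corner graph_dist_grid_opposite_corner ereal.inject
          of_nat_eq_iff)
    \<comment> \<open>The bounds make the subtraction exact, so the two distances add up to
      \<open>m - 1 + 2 * j\<close>; this fixes \<open>j\<close>, and then \<open>i\<close>.\<close>
    with V' show "i = i' \<and> j = j'" by linarith
  qed
  ultimately show ?thesis unfolding locating_coloring_def by blast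
qed

theorem theorem1:
  fixes m n :: nat
  assumes "2 \<le> m" and "m \<le> n"
  shows "\<chi>\<^sub>L (path_graph m \<box> path_graph n) = 4"
proof -
  have "2 \<le> n" using assms by simp
  with assms(1) show ?thesis
    unfolding locating_chromatic_number_def
    by (intro Least_equality) (blast intro: locating_corner_coloring locating_coloring_grid_ge_4)+
qed

end
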